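(* Let $\alpha\in\mathbb{N}$, let $k\in\mathbb{N}$ with $k\le\alpha$, and let $\beta=(\beta_0,\dots,\beta_{k-1})\in\mathbb{C}^k$ be admissible (defined in the context). Let $\hat L^{\alpha;\beta}_n(x)$, $\tau(n)$, $\mathcal{A}$ and $\mathfrak{D}$ be as in the context. Then for every $h\in\mathcal{A}$ there exists a differential operator $\hat B_h\in\mathfrak{D}$ such that $$\hat B_h\,\hat L^{\alpha;\beta}_n(x)=h(n)\,\hat L^{\alpha;\beta}_n(x)\quad\text{for all } n\in\mathbb{N}_0.$$ Consequently $\mathcal{D}=\{\hat B_h:h\in\mathcal{A}\}$ is a commutative subalgebra of $\mathfrak{D}$, isomorphic to $\mathcal{A}$.
   Context: Laguerre polynomials: for $n\in\mathbb{N}_0$, $L^\alpha_n(x)=\frac{\Gamma(\alpha+n+1)}{\Gamma(\alpha+1)\Gamma(n+1)}\,{}_1F_1(-n;\alpha+1;x)$, where ${}_1F_1(a;c;x)=\sum_{j\ge0}\frac{(a)_jx^j}{(c)_jj!}$; by convention $L^\alpha_{-j}(x)=0$ for $j\in\mathbb{N}$. For $j\in\{0,\dots,k-1\}$ define the polynomials in $n$ $$\phi^{1,j}_n=\frac{(-1)^j}{(1-\alpha)_j}\binom{n+j}{j},\qquad \phi^{2,j}_n=\frac{(-1)^j}{j!}\binom{n+\alpha+j}{\alpha+j},$$ and $\psi^{(j)}_n=\sum_{l=0}^{j}\beta_{j-l}\phi^{1,l}_n+\phi^{2,j}_n$. The discrete Wronskian (Casorati determinant) is $\mathrm{Wr}_n(g^{(1)}_n,\dots,g^{(m)}_n)=\det\big(g^{(i)}_{n-j+1}\big)_{1\le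 i,j\le m}$. Set $\tau(n)=\mathrm{Wr}_n(\psi^{(0)}_n,\dots,\psi^{(k-1)}_n)$, a polynomial in $n$. The parameter vector $\beta$ is called admissible if $\tau(n)\neq0$ for $n=-1,0,1,2,\dots$. Define $$\hat L^{\alpha;\beta}_n(x)=\mathrm{Wr}_n\big(\psi^{(0)}_n,\dots,\psi^{(k-1)}_n,L^\alpha_n(x)\big),\quad n\in\mathbb{N}_0,$$ where the $\psi^{(i)}$ are evaluated as polynomials at all integer arguments and $L^\alpha_{m}(x)=0$ for $m<0$. Let $\mathfrak{D}$ be the associative algebra of differential operators generated by $\frac{d}{dx}$ and $x\frac{d^2}{dx^2}-x\frac{d}{dx}$. Let $\mathcal{A}=\{h\in\mathbb{C}[n]: \frac{h(n)-h(n-1)}{\tau(n-1)}\in\mathbb{C}[n]\}$. *)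

theory Defs
  imports "Jordan_Normal_Form.Determinant" "HOL-Computational_Algebra.Polynomial"
begin

definition phi1 :: "nat \<Rightarrow> nat \<Rightarrow> complex poly" where
  "phi1 \<alpha> j = smult ((-1)^j / (pochhammer (1 - of_nat \<alpha>) j * fact j))
                     (pochhammer [:1, 1:] j)"
  (* (-1)^j/(1-alpha)_j * binom(n+j, j),  binom(n+j,j) = (n+1)_j / j! *)

definition phi2 :: "nat \<Rightarrow> nat \<Rightarrow> complex poly" where
  "phi2 \<alpha> j = smult ((-1)^j / (fact j * fact (\<alpha> + j)))
                     (pochhammer [:1, 1:] (\<alpha> + j))"
  (* (-1)^j/j! * binom(n+alpha+j, alpha+j) *)

definition psi :: "nat \<Rightarrow> complex list \<Rightarrow> nat \<Rightarrow> complex poly" where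
  "psi \<alpha> \<beta> j = (\<Sum>l = 0..j. smult (\<beta> ! (j - l)) (phi1 \<alpha> l)) + phi2 \<alpha> j"

text \<open>tau(n) = Wr_n(psi_0, ..., psi_(k-1)) as a polynomial in n; entry (i,j) is psi_i(n-j).\<close>

definition tau :: "nat \<Rightarrow> complex list \<Rightarrow> complex poly" where
  "tau \<alpha> \<beta> = det (mat (length \<beta>) (length \<beta>)
       (\<lambda>(i, j). pcompose (psi \<alpha> \<beta> i) [:- of_nat j, 1:]))"

definition admissible :: "nat \<Rightarrow> complex list \<Rightarrow> bool" where
  "admissible \<alpha> \<beta> \<longleftrightarrow> (\<forall>m::int. m \<ge> -1 \<longrightarrow> poly (tau \<alpha> \<beta>) (of_int m) \<noteq> 0)"

text \<open>Laguerre polynomial L^alpha_m(x) for integer m (zero for m < 0), via 1F1.\<close>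

definition laguerre :: "nat \<Rightarrow> int \<Rightarrow> complex poly" where
  "laguerre \<alpha> m = (if m < 0 then 0 else
     smult (fact (\<alpha> + nat m) / (fact \<alpha> * fact (nat m)))
       (\<Sum>j \<le> nat m. monom (pochhammer (- of_int m) j /
                           (pochhammer (of_nat \<alpha> + 1) j * fact j)) j))"

text \<open>Exceptional Laguerre polynomial hat L^{alpha;beta}_n(x) = Wr_n(psi_0,...,psi_(k-1), L^alpha_n(x)).\<close>

definition Lhat :: "nat \<Rightarrow> complex list \<Rightarrow> nat \<Rightarrow> complex poly" where
  "Lhat \<alpha> \<beta> n = det (mat (length \<beta> + 1) (length \<beta> + 1)
       (\<lambda>(i, j). if i < length \<beta>
                 then [: poly (psi \<alpha> \<beta> i) (of_int (int n - int j)) :]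
                 else laguerre \<alpha> (int n - int j)))"

text \<open>The algebra frak D generated by d/dx and x d^2/dx^2 - x d/dx, realised by its action on C[x].\<close>

definition opD :: "complex poly \<Rightarrow> complex poly" where
  "opD p = pderiv p"

definition opE :: "complex poly \<Rightarrow> complex poly" where
  "opE p = [:0, 1:] * pderiv (pderiv p) - [:0, 1:] * pderiv p"

inductive_set diffAlg :: "(complex poly \<Rightarrow> complex poly) set" where
  unit: "id \<in> diffAlg"
| genD: "opD \<in> diffAlg"
| genE: "opE \<in> diffAlg"
| add: "A \<in> diffAlg \<Longrightarrow> B \<in> diffAlg \<Longrightarrow> (\<lambda>p. A p + B p) \<in> diffAlg"
| scal: "A \<in> diffAlg \<Longrightarrow> (\<lambda>p. smult c (A p)) \<in> diffAlg"
| comp: "A \<in> diffAlg \<Longrightarrow> B \<in> diffAlg \<Longrightarrow> A \<circ> B \<in> diffAlg"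

definition algA :: "nat \<Rightarrow> complex list \<Rightarrow> complex poly set" where
  "algA \<alpha> \<beta> = {h. pcompose (tau \<alpha> \<beta>) [:-1, 1:] dvd (h - pcompose h [:-1, 1:])}"

definition is_eigop :: "nat \<Rightarrow> complex list \<Rightarrow> complex poly \<Rightarrow> (complex poly \<Rightarrow> complex poly) \<Rightarrow> bool" where
  "is_eigop \<alpha> \<beta> h B \<longleftrightarrow> B \<in> diffAlg \<and>
     (\<forall>n. B (Lhat \<alpha> \<beta> n) = smult (poly h (of_nat n)) (Lhat \<alpha> \<beta> n))"

definition Bop :: "nat \<Rightarrow> complex list \<Rightarrow> complex poly \<Rightarrow> (complex poly \<Rightarrow> complex poly)" where
  "Bop \<alpha> \<beta> h = (SOME B. is_eigop \<alpha> \<beta> h B)"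

end

theory Submission
  imports Defs
begin

text \<open>
  Let $P$ be the difference operator with $P w(n) = \mathrm{Wr}_n(\psi^{(0)},\dots,\psi^{(k-1)},w)$
  and let $h(n) - h(n-1) = \tau(n-1) g(n)$. Variation of constants solves $P v = h P w$:
  Cramer's rule gives $d_i$, namely $g$ times polynomial cofactors applied to $w$, such that
  $\sum_i \psi^{(i)}(n-j) d_i(n) = (h(n) - h(n-1)) w(n-j)$ for $1 \le j \le k$, and
  $v = h w - \sum_i \psi^{(i)} C_i$ where $C_i(n) = \sum_{s \le n} d_i(s)$.
  As determinants with a repeated column vanish, $C_i(n)$ may be replaced by
  $\sum_{s<n} r_i(s) w(s)$ with polynomials $r_i$. For $w(n) = L^\alpha_n$, multiplication by $n$ is the
  Laguerre operator $\Lambda$ and $\sum_{s<n} L^\alpha_s = -\frac{d}{dx} L^\alpha_n$, so that $v(n) = B L^\alpha_n$ with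
  $B = h(\Lambda) + \sum_i r_i(\Lambda) \frac{d}{dx} \psi^{(i)}(\Lambda)$, and $B$ commutes with $P$, which acts on $n$ only.
  Admissibility makes $\hat L_n$ a polynomial of degree exactly $n$; these span $\mathbf{C}[x]$ and
  determine the operator, which turns the eigenvalue map into an algebra isomorphism.
\<close>

subsection \<open>Laguerre polynomials\<close>

text \<open>Differentiation multiplies coefficient j+1 by j+1. Absorbing this factor into the
  factorial leaves coefficients j and j+1 with the common prefactor (-1)^j / j!.\<close>

lemma minus_one_power_fact_Suc:
  "of_nat (Suc j) * ((-1) ^ Suc j / fact (Suc j) * x) = - ((-1) ^ j / fact j * x)"
  for x :: complex
proof -
  have "a * (- p / (a * f) * x) = - (p / f * x)" if "a \<noteq> 0" for a p f :: complex
    using that by simp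
  from this[of "of_nat (Suc j)" "(-1) ^ j" "fact j"] show ?thesis
    unfolding fact_Suc by (simp del: of_nat_Suc)
qed

text \<open>The factorials of the prefactor cancel against the Pochhammer symbols. The binomial is
  written so that it vanishes by itself for j > n, so one formula covers all j.\<close>

lemma coeff_laguerre:
  "coeff (laguerre \<alpha> (int n)) j = (-1) ^ j / fact j * of_nat ((n + \<alpha>) choose (\<alpha> + j))"
proof (cases "j \<le> n")
  case True
  have 1: "pochhammer (- of_nat n :: complex) j = (-1) ^ j * (fact n / fact (n - j))"
  proof -
    have "(of_nat n gchoose j :: complex) = (-1) ^ j * pochhammer (- of_nat n) j / fact j"
      by (rule gbinomial_pochhammer)
    moreover have "(of_nat n gchoose j :: complex) = fact n / (fact j * fact (n - j))"
      using True by (simp add: binomial_gbinomial[symmetric] binomial_fact)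
    ultimately show ?thesis
      by (simp add: field_simps power_mult_distrib[symmetric])
  qed
  have 2: "pochhammer (of_nat \<alpha> + 1 :: complex) j = fact (\<alpha> + j) / fact \<alpha>"
    using pochhammer_product[of \<alpha> "\<alpha> + j" "1 :: complex"]
      pochhammer_fact[of \<alpha>, where ?'a = complex] fact_nonzero[of \<alpha>, where ?'a = complex]
    by (simp add: pochhammer_fact add.commute)
  have 3: "(of_nat ((n + \<alpha>) choose (\<alpha> + j)) :: complex)
      = fact (\<alpha> + n) / (fact (\<alpha> + j) * fact (n - j))"
    using True by (simp add: binomial_fact add.commute)
  show ?thesis
    using True unfolding laguerre_def
    by (simp add: coeff_sum 1 2 3 mult_ac)
next
  case False
  then show ?thesis
    by (simp add: laguerre_def coeff_sum)
qed

lemma laguerre_neg: "m < 0 \<Longrightarrow> laguerre \<alpha> m = 0"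
  by (simp add: laguerre_def)

lemma coeff_laguerre_eq_0: "m < int n \<Longrightarrow> coeff (laguerre \<alpha> m) n = 0"
  using coeff_laguerre[of \<alpha> "nat m" n] by (cases "m < 0") (simp_all add: laguerre_neg)

text \<open>The Laguerre operator -(x d^2/dx^2 + (\<alpha> + 1 - x) d/dx), written in the generators
  of \<open>diffAlg\<close>.\<close>

definition opL :: "nat \<Rightarrow> complex poly \<Rightarrow> complex poly" where
  "opL \<alpha> p = - (opE p + smult (of_nat \<alpha> + 1) (opD p))"

text \<open>Comparing coefficients of x^j gives a two-term recurrence, which by the closed form is
  the absorption identity for binomials.\<close>

lemma opL_laguerre_nat:
  "opL \<alpha> (laguerre \<alpha> (int n)) = smult (of_nat n) (laguerre \<alpha> (int n))"
proof (rule poly_eqI)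
  fix j
  let ?b = "\<lambda>j. of_nat ((n + \<alpha>) choose (\<alpha> + j)) :: complex"
  have "Suc (\<alpha> + j) * ((n + \<alpha>) choose Suc (\<alpha> + j)) = (n + \<alpha> - (\<alpha> + j)) * ((n + \<alpha>) choose (\<alpha> + j))"
    by (metis binomial_absorb_comp binomial_absorption mult.commute)
  then have "of_nat (Suc (\<alpha> + j)) * ?b (Suc j) = of_nat (n - j) * ?b j"
    by (metis add_Suc_right add_diff_cancel_right' add.commute diff_diff_left of_nat_mult)
  \<comment> \<open>Truncated subtraction is harmless: for j > n the binomial is 0.\<close>
  moreover have "of_nat (n - j) * ?b j = (of_nat n - of_nat j) * ?b j"
    by (cases "j \<le> n") (simp_all add: of_nat_diff)
  ultimately have "(of_nat \<alpha> + of_nat j + 1) * ?b (Suc j) = (of_nat n - of_nat j) * ?b j"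
    by (simp add: algebra_simps)
  then have *: "(of_nat \<alpha> + of_nat j + 1) * - ((-1) ^ j / fact j * ?b (Suc j))
      = (of_nat j - of_nat n) * ((-1) ^ j / fact j * ?b j)"
    by (simp only: mult.left_commute[of _ "(-1) ^ j / fact j"] mult_minus_right)
      (simp add: algebra_simps)
  have "(of_nat \<alpha> + of_nat j + 1) * (of_nat (Suc j) * coeff (laguerre \<alpha> (int n)) (Suc j))
      = (of_nat j - of_nat n) * coeff (laguerre \<alpha> (int n)) j"
    unfolding coeff_laguerre minus_one_power_fact_Suc by (rule *)
  then show "coeff (opL \<alpha> (laguerre \<alpha> (int n))) j
      = coeff (smult (of_nat n) (laguerre \<alpha> (int n))) j"
    by (cases j) (simp_all add: opL_def opE_def opD_def coeff_pderiv coeff_pCons algebra_simps)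
qed

lemma opL_laguerre:
  "opL \<alpha> (laguerre \<alpha> m) = smult (of_int m) (laguerre \<alpha> m)"
proof (cases "m < 0")
  case True
  then show ?thesis by (simp add: laguerre_neg opL_def opE_def opD_def)
next
  case False
  with opL_laguerre_nat[of \<alpha> "nat m"] show ?thesis by simp
qed

text \<open>Pascal's rule on coefficients gives L_{n+1}' = L_n' - L_n, which telescopes. Thus
  summation over the index becomes a differential operator in x; for negative m both sides are
  0.\<close>

lemma opD_laguerre:
  "opD (laguerre \<alpha> m) = - (\<Sum>s\<in>{0..<m}. laguerre \<alpha> s)"
proof (cases "m < 0")
  case True
  then show ?thesis by (simp add: laguerre_neg opD_def)
next
  case False
  have "pderiv (laguerre \<alpha> (int n)) = - (\<Sum>s<n. laguerre \<alpha> (int s))" for n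
  proof (induction n)
    case 0
    show ?case by (simp add: laguerre_def monom_0 pderiv_pCons)
  next
    case (Suc n)
    have "pderiv (laguerre \<alpha> (int (Suc n))) = pderiv (laguerre \<alpha> (int n)) - laguerre \<alpha> (int n)"
    proof (rule poly_eqI)
      fix j
      show "coeff (pderiv (laguerre \<alpha> (int (Suc n)))) j
          = coeff (pderiv (laguerre \<alpha> (int n)) - laguerre \<alpha> (int n)) j"
        unfolding coeff_pderiv coeff_diff coeff_laguerre minus_one_power_fact_Suc
          add_Suc add_Suc_right binomial_Suc_Suc
        by (simp add: algebra_simps)
    qed
    with Suc show ?case by simp
  qed
  from this[of "nat m"] False show ?thesis
    using sum.reindex_bij_witness[of "{0..<m}" int nat "{..<nat m}" "\<lambda>s. laguerre \<alpha> (int s)" "laguerre \<alpha>"]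
    by (simp add: opD_def)
qed

subsection \<open>The algebra of differential operators\<close>

lemma diffAlg_linear:
  assumes "A \<in> diffAlg"
  shows "A (p + q) = A p + A q" and "A (smult c p) = smult c (A p)"
  using assms
  by (induction arbitrary: p q c rule: diffAlg.induct)
    (simp_all add: opD_def opE_def pderiv_add pderiv_smult pderiv_diff smult_add_right smult_diff_right mult_ac)

lemma diffAlg_0: "A \<in> diffAlg \<Longrightarrow> A 0 = 0"
  using diffAlg_linear(2)[of A 0 0] by simp

lemma diffAlg_sum: "A \<in> diffAlg \<Longrightarrow> A (\<Sum>i\<in>I. f i) = (\<Sum>i\<in>I. A (f i))"
  by (induction I rule: infinite_finite_induct) (simp_all add: diffAlg_0 diffAlg_linear)

lemma diffAlg_minus: "A \<in> diffAlg \<Longrightarrow> A (- p) = - A p"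
  using diffAlg_linear(2)[of A "-1" p] by simp

lemma diffAlg_zero: "(\<lambda>_. 0) \<in> diffAlg"
  using diffAlg.scal[OF diffAlg.unit, of 0] by simp

lemma diffAlg_uminus: "A \<in> diffAlg \<Longrightarrow> (\<lambda>p. - A p) \<in> diffAlg"
  using diffAlg.scal[of A "-1"] by simp

lemma diffAlg_sum_closed:
  "(\<And>i. i \<in> I \<Longrightarrow> A i \<in> diffAlg) \<Longrightarrow> (\<lambda>p. \<Sum>i\<in>I. A i p) \<in> diffAlg"
  by (induction I rule: infinite_finite_induct) (simp_all add: diffAlg_zero diffAlg.add)

lemma opL_diffAlg: "opL \<alpha> \<in> diffAlg"
proof -
  have "opL \<alpha> = (\<lambda>p. - (opE p + smult (of_nat \<alpha> + 1) (opD p)))"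
    by (simp add: opL_def fun_eq_iff)
  then show ?thesis
    by (simp only: diffAlg_uminus diffAlg.intros)
qed

text \<open>Horner's scheme for p(A). Only the action on eigenvectors is recorded, but one B serves
  all eigenvalues and eigenvectors of A at once.\<close>

lemma diffAlg_poly:
  assumes A: "A \<in> diffAlg"
  shows "\<exists>B\<in>diffAlg. \<forall>c v. A v = smult c v \<longrightarrow> B v = smult (poly p c) v"
proof (induction p)
  case 0
  show ?case by (rule bexI[OF _ diffAlg_zero]) simp
next
  case (pCons a p)
  then obtain B where B: "B \<in> diffAlg" "\<And>c v. A v = smult c v \<Longrightarrow> B v = smult (poly p c) v"
    by blast
  show ?case
  proof (rule bexI)
    show "(\<lambda>v. smult a (id v) + (A \<circ> B) v) \<in> diffAlg"
      by (intro diffAlg.intros A B)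
    show "\<forall>c v. A v = smult c v \<longrightarrow> smult a (id v) + (A \<circ> B) v = smult (poly (pCons a p) c) v"
      by (simp add: B(2) diffAlg_linear[OF A] smult_add_left mult.commute)
  qed
qed

text \<open>A sequence with one polynomial of each degree spans C[x], and elements of
  \<open>diffAlg\<close> are linear; the induction removes leading terms.\<close>

lemma diffAlg_eqI:
  assumes A: "A \<in> diffAlg" and B: "B \<in> diffAlg"
    and deg: "\<And>n. degree (v n) = n" and nz: "v 0 \<noteq> 0"
    and eq: "\<And>n. A (v n) = B (v n)"
  shows "A = B"
proof
  fix p :: "complex poly"
  \<comment> \<open>For n > 0 the degree already excludes the zero polynomial, so \<open>nz\<close>
    settles the remaining case.\<close>
  have nz': "lead_coeff (v n) \<noteq> 0" for n
    using deg[of n] nz by (metis degree_0 leading_coeff_0_iff)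
  show "A p = B p"
  proof (induction "degree p" arbitrary: p rule: less_induct)
    case less
    define c where "c = lead_coeff p / lead_coeff (v (degree p))"
    define q where "q = p - smult c (v (degree p))"
    have p: "p = q + smult c (v (degree p))" by (simp add: q_def)
    have "A q = B q"
    proof (cases "q = 0")
      case False
      have "coeff q (degree p) = 0"
        using nz'[of "degree p"] by (simp add: q_def c_def deg)
      moreover have "degree q \<le> degree p"
        unfolding q_def by (intro degree_diff_le) (simp_all add: deg degree_smult_le)
      ultimately have "degree q < degree p"
        using False by (metis le_neq_implies_less leading_coeff_0_iff)
      then show ?thesis by (rule less)
    qed (simp add: diffAlg_0 A B)
    then show ?case
      by (subst (1 2) p) (simp only: diffAlg_linear[OF A] diffAlg_linear[OF B] eq)
  qed
qed

subsection \<open>Casorati determinants\<close>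

text \<open>The p j are the cofactors of the last row and depend on c only. Replacing the last row
  by row i gives two equal rows, hence the orthogonality. In a Casorati matrix the minor for p 0 is
  the same determinant shifted by one, whence \<tau>(n-1).\<close>

lemma det_last_row_expansion:
  fixes c :: "nat \<Rightarrow> nat \<Rightarrow> 'a :: comm_ring_1"
  obtains p where
    "\<And>u. det (mat (Suc k) (Suc k) (\<lambda>(i, j). if i < k then [:c i j:] else u j))
          = (\<Sum>j\<le>k. smult (p j) (u j))"
    "p 0 = (-1) ^ k * det (mat k k (\<lambda>(i, j). c i (Suc j)))"
    "\<And>i. i < k \<Longrightarrow> (\<Sum>j\<le>k. p j * c i j) = 0"
proof -
  \<comment> \<open>The last row of C is a filler: cofactors along that row do not see it.\<close>
  define C where "C = mat (Suc k) (Suc k) (\<lambda>(i, j). if i < k then c i j else 0)"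
  define p where "p j = cofactor C k j" for j
  interpret comm_ring_hom "\<lambda>a :: 'a. [:a:]"
    by unfold_locales (auto simp: one_pCons)
  let ?A = "\<lambda>u. mat (Suc k) (Suc k) (\<lambda>(i, j). if i < k then [:c i j:] else u j)"
  have expand: "det (?A u) = (\<Sum>j\<le>k. smult (p j) (u j))" for u
  proof -
    have "cofactor (?A u) k j = [:p j:]" if "j \<le> k" for j
    proof -
      have "mat_delete (?A u) k j = map_mat (\<lambda>a. [:a:]) (mat_delete C k j)"
        by (rule eq_matI) (auto simp: C_def mat_delete_def)
      then show ?thesis
        by (simp add: cofactor_def p_def hom_distribs)
    qed
    then show ?thesis
      by (subst laplace_expansion_row[where n = "Suc k" and i = k])
        (auto simp: lessThan_Suc_atMost intro!: sum.cong)
  qed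
  show ?thesis
  proof (rule that)
    show "det (?A u) = (\<Sum>j\<le>k. smult (p j) (u j))" for u
      by (rule expand)
    have "mat_delete C k 0 = mat k k (\<lambda>(i, j). c i (Suc j))"
      by (rule eq_matI) (auto simp: C_def mat_delete_def)
    then show "p 0 = (-1) ^ k * det (mat k k (\<lambda>(i, j). c i (Suc j)))"
      by (simp add: p_def cofactor_def)
    fix i assume i: "i < k"
    have "det (?A (\<lambda>j. [:c i j:])) = 0"
      by (rule det_identical_rows[where i = i and j = k and n = "Suc k"]) (use i in \<open>auto intro!: eq_vecI\<close>)
    then have "coeff (\<Sum>j\<le>k. smult (p j) [:c i j:]) 0 = 0"
      unfolding expand by simp
    then show "(\<Sum>j\<le>k. p j * c i j) = 0" by (simp add: coeff_sum)
  qed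
qed

lemma smult_sum_right: "smult c (\<Sum>i\<in>I. f i) = (\<Sum>i\<in>I. smult c (f i))"
  by (induction I rule: infinite_finite_induct) (simp_all add: smult_add_right)

lemma sum_smult_swap:
  "(\<Sum>i\<in>I. smult (a i) (\<Sum>s\<in>S. \<Sum>j\<in>J. smult (b i j s) (x j s)))
    = (\<Sum>j\<in>J. \<Sum>s\<in>S. smult (\<Sum>i\<in>I. a i * b i j s) (x j s))"
proof -
  let ?f = "\<lambda>i j s. smult (a i * b i j s) (x j s)"
  have "(\<Sum>i\<in>I. \<Sum>s\<in>S. \<Sum>j\<in>J. ?f i j s) = (\<Sum>i\<in>I. \<Sum>j\<in>J. \<Sum>s\<in>S. ?f i j s)"
    by (rule sum.cong[OF refl], rule sum.swap)
  also have "\<dots> = (\<Sum>j\<in>J. \<Sum>i\<in>I. \<Sum>s\<in>S. ?f i j s)"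
    by (rule sum.swap)
  also have "\<dots> = (\<Sum>j\<in>J. \<Sum>s\<in>S. \<Sum>i\<in>I. ?f i j s)"
    by (rule sum.cong[OF refl], rule sum.swap)
  finally show ?thesis
    by (simp add: smult_sum smult_sum_right)
qed

text \<open>By \<open>orth\<close>, q at n is a left inverse of the Casorati matrix at n - 1, up to
  the factor h(n) - h(n-1). In the conclusion C i n does not depend on j, so coefficients over the
  window n-k..n that annihilate every \<psi> i carry v to h(n) times the same combination of
  w.\<close>

lemma casorati_variation_of_constants:
  fixes \<psi> :: "nat \<Rightarrow> int \<Rightarrow> 'a :: comm_ring_1" and w :: "int \<Rightarrow> 'a poly"
    and q :: "nat \<Rightarrow> nat \<Rightarrow> int \<Rightarrow> 'a" and h :: "int \<Rightarrow> 'a"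
  assumes w0: "\<And>m. m < 0 \<Longrightarrow> w m = 0"
    and orth: "\<And>j j' n. j < k \<Longrightarrow> j' < k \<Longrightarrow>
      (\<Sum>i<k. \<psi> i (n - 1 - int j') * q i j n) = (if j = j' then h n - h (n - 1) else 0)"
    and v: "\<And>n. v n = smult (h n) (w n)
    - (\<Sum>i<k. smult (\<psi> i n) (\<Sum>s\<in>{0..<n}. smult (\<Sum>j<k. q i j (s + 1 + int j)) (w s)))"
  obtains C where "\<And>n j. j \<le> k \<Longrightarrow> v (n - int j)
    = smult (h n) (w (n - int j)) - (\<Sum>i<k. smult (\<psi> i (n - int j)) (C i n))"
proof -
  define d where "d i s = (\<Sum>j<k. smult (q i j s) (w (s - 1 - int j)))" for i s
  define C where "C i n = (\<Sum>s\<in>{0..n}. d i s)" for i n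
  \<comment> \<open>Freezing the upper summation limit at \<open>n\<close>: by Cramer's rule \<open>F a n\<close> is the same for
    all \<open>n\<close> from \<open>a\<close> to \<open>a + k\<close>, so \<open>P\<close> sees the \<open>C i n\<close> as constants.\<close>
  define F where "F a n = smult (h n) (w a) - (\<Sum>i<k. smult (\<psi> i a) (C i n))" for a n
  \<comment> \<open>Here w is taken at negative arguments only, so starting the sums at 0 loses
    nothing and \<open>C_step\<close> holds for every integer n.\<close>
  have d0: "d i s = 0" if "s \<le> 0" for i s
    using that by (auto simp: d_def w0 intro!: sum.neutral)
  have C_step: "C i n = C i (n - 1) + d i n" for i n
  proof (cases "n < 0")
    case False
    then have "{0..n} = insert n {0..n - 1}" by auto
    then show ?thesis by (simp add: C_def)
  qed (simp add: C_def d0)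
  have "(\<Sum>i<k. smult (\<psi> i (n - 1 - int m)) (d i n)) = smult (h n - h (n - 1)) (w (n - 1 - int m))"
    if "m < k" for m n
  proof -
    have "(\<Sum>i<k. smult (\<psi> i (n - 1 - int m)) (d i n))
        = (\<Sum>j<k. smult (\<Sum>i<k. \<psi> i (n - 1 - int m) * q i j n) (w (n - 1 - int j)))"
      using sum_smult_swap[where S = "{n}" and b = q] by (simp add: d_def)
    also have "\<dots> = (\<Sum>j<k. smult (if j = m then h n - h (n - 1) else 0) (w (n - 1 - int j)))"
      using that by (simp add: orth)
    also have "\<dots> = smult (h n - h (n - 1)) (w (n - 1 - int m))"
      using that by (simp add: if_distrib[of "\<lambda>c. smult c _"] cong: if_cong)
    finally show ?thesis .
  qed
  \<comment> \<open>The increment of h and the increments of the C i cancel at the k points n-1,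
    ..., n-k.\<close>
  then have F_step: "F (n - 1 - int m) n = F (n - 1 - int m) (n - 1)" if "m < k" for m n
    using that
    by (simp add: F_def C_step[of _ n] smult_add_right sum.distrib smult_diff_left)
  have F_const: "m \<le> j \<Longrightarrow> j \<le> k \<Longrightarrow> F (n - int j) (n - int j) = F (n - int j) (n - int j + int m)"
    for m j n
  proof (induction m)
    case (Suc m)
    have "F (n - int j) (n - int j + int (Suc m)) = F (n - int j) (n - int j + int m)"
    proof -
      have "n - int j + int (Suc m) - 1 - int m = n - int j"
        "n - int j + int (Suc m) - 1 = n - int j + int m"
        by simp_all
      then show ?thesis
        using F_step[of m "n - int j + int (Suc m)"] Suc.prems by (metis Suc_le_eq order_trans)
    qed
    with Suc show ?case by simp
  qed simp
  \<comment> \<open>The individual C i n differ from the inner sums in v; only the combinations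
    weighted by \<psi> i n agree.\<close>
  have "(\<Sum>i<k. smult (\<psi> i n) (C i n)) = (\<Sum>i<k. smult (\<psi> i n)
      (\<Sum>s\<in>{0..<n}. smult (\<Sum>j<k. q i j (s + 1 + int j)) (w s)))" for n
  proof -
    define \<kappa> where "\<kappa> j s = (\<Sum>i<k. \<psi> i n * q i j s)" for j s
    \<comment> \<open>Here n = s - 1 - j' with j' = s - 1 - n < j, so \<open>orth\<close> gives an
      off-diagonal entry: the determinant with a repeated column.\<close>
    have \<kappa>0: "\<kappa> j s = 0" if "n < s" "s \<le> n + int j" "j < k" for j s
    proof -
      have "\<kappa> j s = (\<Sum>i<k. \<psi> i (s - 1 - int (nat (s - 1 - n))) * q i j s)"
        using that by (simp add: \<kappa>_def)
      also have "\<dots> = 0"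
        using that by (subst orth) auto
      finally show ?thesis .
    qed
    have "(\<Sum>i<k. smult (\<psi> i n) (C i n))
        = (\<Sum>j<k. \<Sum>s\<in>{0..n}. smult (\<kappa> j s) (w (s - 1 - int j)))"
      by (simp only: C_def d_def \<kappa>_def sum_smult_swap)
    also have "\<dots> = (\<Sum>j<k. \<Sum>s\<in>{0..<n}. smult (\<kappa> j (s + 1 + int j)) (w s))"
    proof (rule sum.cong[OF refl])
      fix j assume j: "j \<in> {..<k}"
      let ?f = "\<lambda>s. smult (\<kappa> j s) (w (s - 1 - int j))"
      \<comment> \<open>The range grows to n + j by \<open>\<kappa>0\<close> and shrinks to start at
        1 + j because w vanishes at negative arguments. The shift by 1 + j then gives 0..<n for
        every j.\<close>
      have "(\<Sum>s\<in>{0..n}. ?f s) = (\<Sum>s\<in>{0..n + int j}. ?f s)"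
        using j by (intro sum.mono_neutral_left) (auto simp: \<kappa>0)
      also have "\<dots> = (\<Sum>s\<in>{1 + int j..n + int j}. ?f s)"
        using j by (intro sum.mono_neutral_right) (auto simp: w0)
      also have "\<dots> = (\<Sum>s\<in>{0..<n}. smult (\<kappa> j (s + 1 + int j)) (w s))"
        by (rule sum.reindex_bij_witness[of _ "\<lambda>s. s + 1 + int j" "\<lambda>s. s - 1 - int j"]) auto
      finally show "(\<Sum>s\<in>{0..n}. ?f s) = \<dots>" .
    qed
    also have "\<dots> = (\<Sum>i<k. smult (\<psi> i n)
      (\<Sum>s\<in>{0..<n}. smult (\<Sum>j<k. q i j (s + 1 + int j)) (w s)))"
      unfolding \<kappa>_def sum_smult_swap[symmetric] by (simp only: smult_sum)
    finally show ?thesis .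
  qed
  then have "v n = F n n" for n
    by (simp add: v F_def)
  with F_const have "v (n - int j) = F (n - int j) n" if "j \<le> k" for n j
    using that by (metis diff_add_cancel order_refl)
  then show ?thesis
    using that[of C] by (simp add: F_def)
qed

section \<open>The determinants \<open>tau\<close> and \<open>Lhat\<close>\<close>

lemma poly_tau:
  "poly (tau \<alpha> \<beta>) x
    = det (mat (length \<beta>) (length \<beta>) (\<lambda>(i, j). poly (psi \<alpha> \<beta> i) (x - of_nat j)))"
proof -
  interpret comm_ring_hom "\<lambda>p. poly p x"
    by unfold_locales auto
  show ?thesis
    unfolding tau_def hom_det[symmetric]
    by (rule arg_cong[of _ _ det], rule eq_matI) (auto simp: poly_pcompose)
qed

text \<open>Cramer's rule through the adjugate, taken over the polynomial ring: the entries a j i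
  are polynomials in n, so they can later be evaluated at \<open>opL\<close>.\<close>

lemma tau_adjugate:
  obtains a where "\<And>j j'. j < length \<beta> \<Longrightarrow> j' < length \<beta> \<Longrightarrow>
    (\<Sum>i<length \<beta>. a j i * pcompose (psi \<alpha> \<beta> i) [:- of_nat j', 1:])
      = (if j = j' then tau \<alpha> \<beta> else 0)"
proof -
  let ?k = "length \<beta>"
  define M where "M = mat ?k ?k (\<lambda>(i, j). pcompose (psi \<alpha> \<beta> i) [:- of_nat j, 1:])"
  have M: "M \<in> carrier_mat ?k ?k" by (simp add: M_def)
  have dim: "dim_row (adj_mat M) = ?k" "dim_col (adj_mat M) = ?k"
    using adj_mat(1)[OF M] by auto
  show ?thesis
  proof (rule that[of "\<lambda>j i. adj_mat M $$ (j, i)"])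
    fix j j' assume j: "j < ?k" "j' < ?k"
    have "(adj_mat M * M) $$ (j, j')
        = (\<Sum>i<?k. adj_mat M $$ (j, i) * pcompose (psi \<alpha> \<beta> i) [:- of_nat j', 1:])"
      using j dim by (auto simp: M_def scalar_prod_def atLeast0LessThan intro!: sum.cong)
    moreover have "(adj_mat M * M) $$ (j, j') = (if j = j' then tau \<alpha> \<beta> else 0)"
      unfolding adj_mat(3)[OF M] using j by (simp add: tau_def M_def)
    ultimately show "(\<Sum>i<?k. adj_mat M $$ (j, i) * pcompose (psi \<alpha> \<beta> i) [:- of_nat j', 1:])
        = (if j = j' then tau \<alpha> \<beta> else 0)"
      by simp
  qed
qed

text \<open>The coefficients p n j do not involve x, so linear operators on C[x] pass through to the
  Laguerre polynomials.\<close>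

lemma Lhat_expansion:
  obtains p where
    "\<And>n. Lhat \<alpha> \<beta> n = (\<Sum>j\<le>length \<beta>. smult (p n j) (laguerre \<alpha> (int n - int j)))"
    "\<And>n. p n 0 = (-1) ^ length \<beta> * poly (tau \<alpha> \<beta>) (of_int (int n - 1))"
    "\<And>n i. i < length \<beta> \<Longrightarrow>
      (\<Sum>j\<le>length \<beta>. p n j * poly (psi \<alpha> \<beta> i) (of_int (int n - int j))) = 0"
proof -
  have "\<forall>n. \<exists>p. Lhat \<alpha> \<beta> n = (\<Sum>j\<le>length \<beta>. smult (p j) (laguerre \<alpha> (int n - int j)))
    \<and> p 0 = (-1) ^ length \<beta> * poly (tau \<alpha> \<beta>) (of_int (int n - 1))
    \<and> (\<forall>i<length \<beta>. (\<Sum>j\<le>length \<beta>. p j * poly (psi \<alpha> \<beta> i) (of_int (int n - int j))) = 0)"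
    (is "\<forall>n. \<exists>p. ?Q n p")
  proof
    fix n
    obtain p where p:
      "\<And>u. det (mat (Suc (length \<beta>)) (Suc (length \<beta>)) (\<lambda>(i, j). if i < length \<beta>
          then [:poly (psi \<alpha> \<beta> i) (of_int (int n - int j)):] else u j))
        = (\<Sum>j\<le>length \<beta>. smult (p j) (u j))"
      "p 0 = (-1) ^ length \<beta> * det (mat (length \<beta>) (length \<beta>)
        (\<lambda>(i, j). poly (psi \<alpha> \<beta> i) (of_int (int n - int (Suc j)))))"
      "\<And>i. i < length \<beta> \<Longrightarrow>
        (\<Sum>j\<le>length \<beta>. p j * poly (psi \<alpha> \<beta> i) (of_int (int n - int j))) = 0"
      using det_last_row_expansion[of "length \<beta>" "\<lambda>i j. poly (psi \<alpha> \<beta> i) (of_int (int n - int j))"]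
      by blast
    have "p 0 = (-1) ^ length \<beta> * poly (tau \<alpha> \<beta>) (of_int (int n - 1))"
      unfolding p(2) poly_tau by (simp add: algebra_simps)
    with p(1,3) show "\<exists>p. ?Q n p"
      unfolding Lhat_def by (intro exI[of _ p]) simp
  qed
  from choice[OF this] obtain p where p: "\<forall>n. ?Q n (p n)" ..
  show ?thesis
    by (rule that[of p]) (use p in blast)+
qed

text \<open>Only the term j = 0 reaches degree n, and its factor is \<tau>(n-1) up to sign. For n =
  0 this is \<tau>(-1), the first value that admissibility covers.\<close>

lemma Lhat_degree:
  assumes "admissible \<alpha> \<beta>"
  shows "degree (Lhat \<alpha> \<beta> n) = n" and "Lhat \<alpha> \<beta> n \<noteq> 0"
proof -
  obtain p where p:
    "Lhat \<alpha> \<beta> n = (\<Sum>j\<le>length \<beta>. smult (p j) (laguerre \<alpha> (int n - int j)))"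
    "p 0 = (-1) ^ length \<beta> * poly (tau \<alpha> \<beta>) (of_int (int n - 1))"
    using Lhat_expansion[of \<alpha> \<beta>] by metis
  have "coeff (Lhat \<alpha> \<beta> n) m = (\<Sum>j\<in>{0}. p j * coeff (laguerre \<alpha> (int n - int j)) m)"
    if "m \<ge> n" for m
    unfolding p(1) coeff_sum coeff_smult
    using that by (intro sum.mono_neutral_right) (auto simp: coeff_laguerre_eq_0)
  then have c: "coeff (Lhat \<alpha> \<beta> n) m = p 0 * coeff (laguerre \<alpha> (int n)) m" if "m \<ge> n" for m
    using that by simp
  have "p 0 \<noteq> 0"
    using assms p(2) by (simp add: admissible_def del: of_int_diff)
  then have nz: "coeff (Lhat \<alpha> \<beta> n) n \<noteq> 0"
    by (simp add: c coeff_laguerre add.commute)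
  then show "Lhat \<alpha> \<beta> n \<noteq> 0" by auto
  have "degree (Lhat \<alpha> \<beta> n) \<le> n"
    by (rule degree_le) (simp add: c coeff_laguerre_eq_0)
  with nz show "degree (Lhat \<alpha> \<beta> n) = n"
    by (simp add: le_antisym le_degree)
qed

subsection \<open>Eigenoperators\<close>

lemma is_eigop_exists:
  assumes "h \<in> algA \<alpha> \<beta>"
  shows "\<exists>B. is_eigop \<alpha> \<beta> h B"
proof -
  define k where "k = length \<beta>"
  define \<psi> where "\<psi> = psi \<alpha> \<beta>"
  define w where "w = laguerre \<alpha>"
  obtain g where g: "h - pcompose h [:-1, 1:] = pcompose (tau \<alpha> \<beta>) [:-1, 1:] * g"
    using assms by (auto simp: algA_def)
  obtain a where a: "\<And>j j'. j < k \<Longrightarrow> j' < k \<Longrightarrow>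
      (\<Sum>i<k. a j i * pcompose (\<psi> i) [:- of_nat j', 1:]) = (if j = j' then tau \<alpha> \<beta> else 0)"
    using tau_adjugate[of \<beta> \<alpha>] unfolding k_def \<psi>_def by blast
  obtain p where p:
    "\<And>n. Lhat \<alpha> \<beta> n = (\<Sum>j\<le>k. smult (p n j) (w (int n - int j)))"
    "\<And>n. p n 0 = (-1) ^ k * poly (tau \<alpha> \<beta>) (of_int (int n - 1))"
    "\<And>n i. i < k \<Longrightarrow> (\<Sum>j\<le>k. p n j * poly (\<psi> i) (of_int (int n - int j))) = 0"
    by (rule Lhat_expansion[of \<alpha> \<beta>, folded k_def \<psi>_def w_def]) (rule that)
  \<comment> \<open>The adjugate is taken at n - 1, so the factor g(n) turns \<tau>(n-1) into h(n) -
    h(n-1).\<close>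
  define q where "q i j n = poly g (of_int n) * poly (a j i) (of_int (n - 1))" for i j and n :: int
  have orth: "(\<Sum>i<k. poly (\<psi> i) (of_int (n - 1 - int j')) * q i j n)
      = (if j = j' then poly h (of_int n) - poly h (of_int (n - 1)) else 0)"
    if j: "j < k" "j' < k" for j j' n
  proof -
    have "(\<Sum>i<k. poly (\<psi> i) (of_int (n - 1 - int j')) * q i j n)
        = poly g (of_int n)
          * poly (\<Sum>i<k. a j i * pcompose (\<psi> i) [:- of_nat j', 1:]) (of_int (n - 1))"
      by (simp add: q_def poly_sum poly_pcompose sum_distrib_left algebra_simps)
    also have "\<dots> = (if j = j' then poly (pcompose (tau \<alpha> \<beta>) [:-1, 1:] * g) (of_int n) else 0)"
      unfolding a[OF j] by (simp add: poly_pcompose)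
    also have "\<dots> = (if j = j' then poly h (of_int n) - poly h (of_int (n - 1)) else 0)"
      unfolding g[symmetric] by (simp add: poly_pcompose)
    finally show ?thesis .
  qed
  define v where "v n = smult (poly h (of_int n)) (w n)
    - (\<Sum>i<k. smult (poly (\<psi> i) (of_int n))
        (\<Sum>s\<in>{0..<n}. smult (\<Sum>j<k. q i j (s + 1 + int j)) (w s)))" for n
  have w0: "w m = 0" if "m < 0" for m
    using that by (simp add: w_def laguerre_neg)
  obtain C where C: "\<And>n j. j \<le> k \<Longrightarrow> v (n - int j) = smult (poly h (of_int n)) (w (n - int j))
      - (\<Sum>i<k. smult (poly (\<psi> i) (of_int (n - int j))) (C i n))"
    by (rule casorati_variation_of_constants[of w k "\<lambda>i n. poly (\<psi> i) (of_int n)" q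
      "\<lambda>n. poly h (of_int n)" v])
      (erule w0, erule (1) orth, rule v_def, rule that)
  \<comment> \<open>\<open>Op p\<close> plays the role of p(\<open>opL\<close>): on w m it
    multiplies by p(m).\<close>
  have "\<exists>B\<in>diffAlg. \<forall>m. B (w m) = smult (poly p (of_int m)) (w m)" for p
    using diffAlg_poly[OF opL_diffAlg[of \<alpha>], of p] opL_laguerre[of \<alpha>] unfolding w_def by blast
  then obtain Op where Op: "\<And>p. Op p \<in> diffAlg"
      "\<And>p m. Op p (w m) = smult (poly p (of_int m)) (w m)"
    by metis
  define r where "r i = (\<Sum>j<k. pcompose g [:1 + of_nat j, 1:] * pcompose (a j i) [:of_nat j, 1:])" for i
  have r: "poly (r i) (of_int s) = (\<Sum>j<k. q i j (s + 1 + int j))" for i s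
    by (simp add: r_def q_def poly_sum poly_pcompose algebra_simps)
  \<comment> \<open>The order matters: \<psi> i acts first and gives \<psi> i (m), then d/dx gives
    minus the sum of w s over s < m, and r i acts last, weighting each summand by r i (s). The sign
    from d/dx is the minus in v.\<close>
  define B where "B p = Op h p + (\<Sum>i<k. (Op (r i) \<circ> (opD \<circ> Op (\<psi> i))) p)" for p
  have B: "B \<in> diffAlg"
    unfolding B_def by (intro diffAlg.intros diffAlg_sum_closed Op)
  have "(Op (r i) \<circ> (opD \<circ> Op (\<psi> i))) (w m)
      = - smult (poly (\<psi> i) (of_int m)) (\<Sum>s\<in>{0..<m}. smult (poly (r i) (of_int s)) (w s))" for i m
    by (simp add: Op diffAlg_linear[OF diffAlg.genD] diffAlg_linear[OF Op(1)] diffAlg_minus[OF Op(1)]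
        opD_laguerre[of \<alpha> m, folded w_def] diffAlg_sum[OF Op(1)])
  then have Bw: "B (w m) = v m" for m
    by (simp add: B_def v_def Op(2) r sum_negf)
  have "B (Lhat \<alpha> \<beta> n) = smult (poly h (of_nat n)) (Lhat \<alpha> \<beta> n)" for n
  proof -
    have "B (Lhat \<alpha> \<beta> n) = (\<Sum>j\<le>k. smult (p n j) (v (int n - int j)))"
      by (simp add: p(1) diffAlg_sum[OF B] diffAlg_linear[OF B] Bw)
    \<comment> \<open>Every v in the window n-k..n is rewritten with the same h(n) and the same C i
      n; the orthogonality of p n to \<psi> i then removes the C part.\<close>
    also have "\<dots> = smult (poly h (of_nat n)) (Lhat \<alpha> \<beta> n)
        - (\<Sum>j\<le>k. \<Sum>i<k. smult (p n j * poly (\<psi> i) (of_int (int n - int j))) (C i (int n)))"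
      by (simp add: C p(1) smult_diff_right smult_sum_right sum_subtractf mult.commute
          del: of_int_diff)
    also have "(\<Sum>j\<le>k. \<Sum>i<k. smult (p n j * poly (\<psi> i) (of_int (int n - int j))) (C i (int n)))
        = (\<Sum>i<k. smult (\<Sum>j\<le>k. p n j * poly (\<psi> i) (of_int (int n - int j))) (C i (int n)))"
      unfolding smult_sum by (rule sum.swap)
    also have "\<dots> = 0"
      by (simp add: p(3) del: of_int_diff)
    finally show ?thesis by simp
  qed
  with B show ?thesis
    by (auto simp: is_eigop_def)
qed

section \<open>Uniqueness and the algebra isomorphism\<close>

lemma is_eigop_unique:
  assumes "admissible \<alpha> \<beta>" "is_eigop \<alpha> \<beta> h A" "is_eigop \<alpha> \<beta> h B"
  shows "A = B"
  using assms diffAlg_eqI[of A B "Lhat \<alpha> \<beta>"] Lhat_degree[OF assms(1)]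
  by (simp add: is_eigop_def)

lemma is_eigop_Bop: "h \<in> algA \<alpha> \<beta> \<Longrightarrow> is_eigop \<alpha> \<beta> h (Bop \<alpha> \<beta> h)"
  unfolding Bop_def by (metis is_eigop_exists someI)

text \<open>By uniqueness any exhibited eigenoperator is the one that \<open>SOME\<close> selects,
  so identities between values of \<open>Bop\<close> reduce to comparing eigenvalues.\<close>

lemma Bop_eqI:
  assumes "admissible \<alpha> \<beta>" "is_eigop \<alpha> \<beta> h B"
  shows "Bop \<alpha> \<beta> h = B"
  using assms is_eigop_unique unfolding Bop_def by (metis someI)

lemma is_eigop_add:
  "is_eigop \<alpha> \<beta> h1 A \<Longrightarrow> is_eigop \<alpha> \<beta> h2 B \<Longrightarrow> is_eigop \<alpha> \<beta> (h1 + h2) (\<lambda>p. A p + B p)"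
  by (simp add: is_eigop_def diffAlg.add smult_add_left)

lemma is_eigop_smult:
  "is_eigop \<alpha> \<beta> h A \<Longrightarrow> is_eigop \<alpha> \<beta> (smult c h) (\<lambda>p. smult c (A p))"
  by (simp add: is_eigop_def diffAlg.scal)

lemma is_eigop_mult:
  "is_eigop \<alpha> \<beta> h1 A \<Longrightarrow> is_eigop \<alpha> \<beta> h2 B \<Longrightarrow> is_eigop \<alpha> \<beta> (h1 * h2) (A \<circ> B)"
  by (simp add: is_eigop_def diffAlg.comp diffAlg_linear mult.commute)

lemma is_eigop_one: "is_eigop \<alpha> \<beta> 1 id"
  by (simp add: is_eigop_def diffAlg.unit)

text \<open>As no \<open>Lhat\<close> vanishes, the operator determines h at all natural numbers,
  hence h.\<close>

lemma inj_on_Bop: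
  assumes "admissible \<alpha> \<beta>"
  shows "inj_on (Bop \<alpha> \<beta>) (algA \<alpha> \<beta>)"
proof (rule inj_onI)
  fix h1 h2 assume h: "h1 \<in> algA \<alpha> \<beta>" "h2 \<in> algA \<alpha> \<beta>" "Bop \<alpha> \<beta> h1 = Bop \<alpha> \<beta> h2"
  have "smult (poly h1 (of_nat n)) (Lhat \<alpha> \<beta> n) = smult (poly h2 (of_nat n)) (Lhat \<alpha> \<beta> n)" for n
    using is_eigop_Bop[OF h(1)] is_eigop_Bop[OF h(2)] h(3) by (simp add: is_eigop_def)
  then have "smult (poly (h1 - h2) (of_nat n)) (Lhat \<alpha> \<beta> n) = 0" for n
    by (simp add: smult_diff_left)
  then have "poly (h1 - h2) (of_nat n) = 0" for n
    using Lhat_degree(2)[OF assms] by (metis smult_eq_0_iff)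
  then have "range of_nat \<subseteq> {x. poly (h1 - h2) x = 0}"
    by auto
  moreover have "infinite (range (of_nat :: nat \<Rightarrow> complex))"
    by (simp add: range_inj_infinite inj_of_nat)
  ultimately have "h1 - h2 = 0"
    using poly_roots_finite finite_subset by blast
  then show "h1 = h2" by simp
qed

theorem theorem4p1:
  fixes \<alpha> k :: nat and \<beta> :: "complex list"
  assumes "k \<le> \<alpha>" and "length \<beta> = k" and "admissible \<alpha> \<beta>"
  shows "(\<forall>h \<in> algA \<alpha> \<beta>. \<exists>B \<in> diffAlg.
            \<forall>n. B (Lhat \<alpha> \<beta> n) = smult (poly h (of_nat n)) (Lhat \<alpha> \<beta> n))
       \<and> Bop \<alpha> \<beta> ` algA \<alpha> \<beta> \<subseteq> diffAlg
       \<and> inj_on (Bop \<alpha> \<beta>) (algA \<alpha> \<beta>)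
       \<and> Bop \<alpha> \<beta> 1 = id
       \<and> (\<forall>h1 \<in> algA \<alpha> \<beta>. \<forall>h2 \<in> algA \<alpha> \<beta>.
            Bop \<alpha> \<beta> (h1 + h2) = (\<lambda>p. Bop \<alpha> \<beta> h1 p + Bop \<alpha> \<beta> h2 p)
          \<and> Bop \<alpha> \<beta> (h1 * h2) = Bop \<alpha> \<beta> h1 \<circ> Bop \<alpha> \<beta> h2
          \<and> Bop \<alpha> \<beta> h1 \<circ> Bop \<alpha> \<beta> h2 = Bop \<alpha> \<beta> h2 \<circ> Bop \<alpha> \<beta> h1)
       \<and> (\<forall>c. \<forall>h \<in> algA \<alpha> \<beta>. Bop \<alpha> \<beta> (smult c h) = (\<lambda>p. smult c (Bop \<alpha> \<beta> h p)))"
proof (intro conjI ballI allI)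
  note adm = assms(3)
  note Bop = is_eigop_Bop[of _ \<alpha> \<beta>]
  show "\<exists>B\<in>diffAlg. \<forall>n. B (Lhat \<alpha> \<beta> n) = smult (poly h (of_nat n)) (Lhat \<alpha> \<beta> n)"
    if "h \<in> algA \<alpha> \<beta>" for h
    using Bop[OF that] by (auto simp: is_eigop_def)
  show "Bop \<alpha> \<beta> ` algA \<alpha> \<beta> \<subseteq> diffAlg"
    using Bop by (auto simp: is_eigop_def)
  show "inj_on (Bop \<alpha> \<beta>) (algA \<alpha> \<beta>)"
    by (rule inj_on_Bop[OF adm])
  show "Bop \<alpha> \<beta> 1 = id"
    by (rule Bop_eqI[OF adm is_eigop_one])
  show "Bop \<alpha> \<beta> (smult c h) = (\<lambda>p. smult c (Bop \<alpha> \<beta> h p))" if "h \<in> algA \<alpha> \<beta>" for c h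
    by (rule Bop_eqI[OF adm is_eigop_smult[OF Bop[OF that]]])
  fix h1 h2 assume h: "h1 \<in> algA \<alpha> \<beta>" "h2 \<in> algA \<alpha> \<beta>"
  show "Bop \<alpha> \<beta> (h1 + h2) = (\<lambda>p. Bop \<alpha> \<beta> h1 p + Bop \<alpha> \<beta> h2 p)"
    by (rule Bop_eqI[OF adm is_eigop_add[OF Bop[OF h(1)] Bop[OF h(2)]]])
  show mult: "Bop \<alpha> \<beta> (h1 * h2) = Bop \<alpha> \<beta> h1 \<circ> Bop \<alpha> \<beta> h2"
    by (rule Bop_eqI[OF adm is_eigop_mult[OF Bop[OF h(1)] Bop[OF h(2)]]])
  \<comment> \<open>Both compositions are \<open>Bop\<close> of the same product, so commutativity
    is inherited from C[n].\<close>
  show "Bop \<alpha> \<beta> h1 \<circ> Bop \<alpha> \<beta> h2 = Bop \<alpha> \<beta> h2 \<circ> Bop \<alpha> \<beta> h1"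
    using mult Bop_eqI[OF adm is_eigop_mult[OF Bop[OF h(2)] Bop[OF h(1)]]] by (simp add: mult.commute)
qed

end
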